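(* Let $D\subset\mathbb{R}^2$ be open and let $f,\nu:D\to\mathbb{R}^4\setminus\{0\}$ be smooth with $\langle f,\nu\rangle=0$, related by the elliptic projective Lelieuvre map, i.e. $f\wedge f_x=-\star(\nu\wedge\nu_y)$ and $f\wedge f_y=\star(\nu\wedge\nu_x)$ on $D$. Then $$\det|f,f_x,f_y,f_{xx}|=-\det|\nu,\nu_x,\nu_y,\nu_{xx}|,\qquad \det|f,f_x,f_y,f_{yy}|=-\det|\nu,\nu_x,\nu_y,\nu_{yy}|.$$
   Context: $f=(f_1,\dots,f_4)$ and $\nu=(\nu_1,\dots,\nu_4)$ are homogeneous coordinate vectors of surfaces in $P^3$ and in the dual space $P_3$, depending on real variables $(x,y)$; subscripts $x,y$ denote partial derivatives; $\langle f,\nu\rangle=\sum_i f_i\nu_i$. $\varepsilon$ is the totally alternating symbol with $\varepsilon_{1234}=1$. For $a,b\in\mathbb{R}^4$, $(a\wedge b)_{ik}=a_ib_k-a_kb_i$; for a skew-symmetric $T$, $(\star T)_{ik}=\frac12\sum_{l,m}\varepsilon_{lmik}T_{lm}$. Thus the equations of the map read $f_if_{k,x}-f_kf_{i,x}=-\sum_{l,m}\varepsilon_{iklm}\nu_l\nu_{m,y}$ and $f_if_{k,y}-f_kf_{i,y}=\sum_{l,m}\varepsilon_{iklm}\nu_l\nu_{m,x}$ for $i,k=1,\dots,4$. $\det|a_1,a_2,a_3,a_4|$ is the determinant of the matrix formed by the four vectors. *)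

theory Defs
  imports "HOL-Analysis.Analysis"
begin

text \<open>On an open set \<open>D\<close>, \<open>Ck_on k D f\<close> says that \<open>f\<close> is \<open>k\<close> times continuously differentiable:
  the recursion runs over all directional derivatives of the total derivative.\<close>

primrec Ck_on :: "nat \<Rightarrow> 'a::euclidean_space set \<Rightarrow> ('a \<Rightarrow> 'b::real_normed_vector) \<Rightarrow> bool" where
  "Ck_on 0 D f \<longleftrightarrow> continuous_on D f"
| "Ck_on (Suc k) D f \<longleftrightarrow> (\<forall>p\<in>D. f differentiable (at p)) \<and>
     (\<forall>v. Ck_on k D (\<lambda>p. frechet_derivative f (at p) v))"

definition smooth_on :: "'a::euclidean_space set \<Rightarrow> ('a \<Rightarrow> 'b::real_normed_vector) \<Rightarrow> bool" where
  "smooth_on D f \<longleftrightarrow> (\<forall>k. Ck_on k D f)"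

definition partial_x :: "(real \<times> real \<Rightarrow> 'b::real_normed_vector) \<Rightarrow> real \<times> real \<Rightarrow> 'b" where
  "partial_x f p = vector_derivative (\<lambda>t. f (t, snd p)) (at (fst p))"

definition partial_y :: "(real \<times> real \<Rightarrow> 'b::real_normed_vector) \<Rightarrow> real \<times> real \<Rightarrow> 'b" where
  "partial_y f p = vector_derivative (\<lambda>t. f (fst p, t)) (at (snd p))"

text \<open>In the index type \<open>4\<close> the numeral \<open>4\<close> equals \<open>0\<close>, but the constructor \<open>vector\<close> fills the
  positions \<open>1, 2, 3, 4\<close> in this order. The vector of indices below is hence the map
  \<open>1 \<mapsto> i, 2 \<mapsto> j, 3 \<mapsto> k, 4 \<mapsto> l\<close>, a permutation iff the four indices are distinct.\<close>

definition levi_civita :: "4 \<Rightarrow> 4 \<Rightarrow> 4 \<Rightarrow> 4 \<Rightarrow> real" where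
  "levi_civita i j k l =
     (if distinct [i, j, k, l] then of_int (sign (($) (vector [i, j, k, l] :: 4^4))) else 0)"

definition wedge :: "real^4 \<Rightarrow> real^4 \<Rightarrow> real^4^4" where
  "wedge a b = (\<chi> i k. a $ i * b $ k - a $ k * b $ i)"

definition hodge_star :: "real^4^4 \<Rightarrow> real^4^4" where
  "hodge_star T = (\<chi> i k. 1/2 * (\<Sum>l\<in>UNIV. \<Sum>m\<in>UNIV. levi_civita l m i k * T $ l $ m))"

definition det4 :: "real^4 \<Rightarrow> real^4 \<Rightarrow> real^4 \<Rightarrow> real^4 \<Rightarrow> real" where
  "det4 a b c d = det (vector [a, b, c, d] :: real^4^4)"

definition elliptic_lelieuvre_on ::
    "(real \<times> real) set \<Rightarrow> (real \<times> real \<Rightarrow> real^4) \<Rightarrow> (real \<times> real \<Rightarrow> real^4) \<Rightarrow> bool" where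
  "elliptic_lelieuvre_on D f \<nu> \<longleftrightarrow>
     (\<forall>p\<in>D. wedge (f p) (partial_x f p) = - hodge_star (wedge (\<nu> p) (partial_y \<nu> p)) \<and>
            wedge (f p) (partial_y f p) = hodge_star (wedge (\<nu> p) (partial_x \<nu> p)))"

end

theory Submission
  imports Defs
begin

text \<open>The map says that the bivector \<open>f \<and> f\<^sub>x\<close> is Hodge dual to \<open>\<nu>\<^sub>y \<and> \<nu>\<close>, so
  \<open>det(f, f\<^sub>x, u, v) = \<langle>\<nu>\<^sub>y,u\<rangle>\<langle>\<nu>,v\<rangle> - \<langle>\<nu>\<^sub>y,v\<rangle>\<langle>\<nu>,u\<rangle>\<close>, and similarly for the \<open>y\<close>-equation and
  with \<open>f\<close> and \<open>\<nu>\<close> exchanged. Repeating a column and using \<open>\<nu> \<noteq> 0\<close> gives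
  \<open>\<langle>f\<^sub>x,\<nu>\<rangle> = \<langle>f\<^sub>y,\<nu>\<rangle> = \<langle>f,\<nu>\<^sub>x\<rangle> = \<langle>f,\<nu>\<^sub>y\<rangle> = 0\<close>; evaluating \<open>det(f, f\<^sub>x, f\<^sub>y, \<nu>)\<close> by either equation
  gives \<open>\<langle>f\<^sub>x,\<nu>\<^sub>x\<rangle> = \<langle>f\<^sub>y,\<nu>\<^sub>y\<rangle>\<close>. Call this number \<open>a\<close>. Then \<open>det(f, f\<^sub>x, f\<^sub>y, v) = a\<langle>\<nu>,v\<rangle>\<close> and
  \<open>det(\<nu>, \<nu>\<^sub>x, \<nu>\<^sub>y, v) = -a\<langle>f,v\<rangle>\<close>, while differentiating the tangency relations gives
  \<open>\<langle>\<nu>,f\<^sub>x\<^sub>x\<rangle> = \<langle>f,\<nu>\<^sub>x\<^sub>x\<rangle> = -a\<close>, and likewise for \<open>yy\<close>. Hence the two determinants are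
  \<open>-a\<^sup>2\<close> and \<open>a\<^sup>2\<close>.\<close>

section \<open>Determinants and the Hodge star in dimension four\<close>

lemma vector_4:
  "(vector [a, b, c, d] :: ('a::zero)^4) $ 1 = a"
  "(vector [a, b, c, d] :: ('a::zero)^4) $ 2 = b"
  "(vector [a, b, c, d] :: ('a::zero)^4) $ 3 = c"
  "(vector [a, b, c, d] :: ('a::zero)^4) $ 4 = d"
  unfolding vector_def by simp_all

text \<open>Laplace expansion along the first two rows. Each product pairs a minor of these rows
  with its complementary minor, and the first factors become entries of a
  \<open>wedge\<close>.\<close>

lemma det_4:
  "det (A :: 'a::comm_ring_1^4^4) =
     (A$1$1 * A$2$2 - A$1$2 * A$2$1) * (A$3$3 * A$4$4 - A$3$4 * A$4$3)
   - (A$1$1 * A$2$3 - A$1$3 * A$2$1) * (A$3$2 * A$4$4 - A$3$4 * A$4$2)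
   + (A$1$1 * A$2$4 - A$1$4 * A$2$1) * (A$3$2 * A$4$3 - A$3$3 * A$4$2)
   + (A$1$2 * A$2$3 - A$1$3 * A$2$2) * (A$3$1 * A$4$4 - A$3$4 * A$4$1)
   - (A$1$2 * A$2$4 - A$1$4 * A$2$2) * (A$3$1 * A$4$3 - A$3$3 * A$4$1)
   + (A$1$3 * A$2$4 - A$1$4 * A$2$3) * (A$3$1 * A$4$2 - A$3$2 * A$4$1)"
proof -
  have f: "finite {2::4, 3, 4}" "1 \<notin> {2::4, 3, 4}" "finite {3::4, 4}" "2 \<notin> {3::4, 4}"
    "finite {4::4}" "3 \<notin> {4::4}"
    by auto
  show ?thesis
    unfolding det_def UNIV_4
    unfolding sum_over_permutations_insert[OF f(1,2)]
    unfolding sum_over_permutations_insert[OF f(3,4)]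
    unfolding sum_over_permutations_insert[OF f(5,6)]
    unfolding permutes_sing
    by (simp add: sign_swap_id permutation_swap_id sign_compose sign_id permutation_compose
        transpose_def algebra_simps)
qed

lemma det4_expand:
  "det4 a b c d =
     (a$1 * b$2 - a$2 * b$1) * (c$3 * d$4 - c$4 * d$3)
   - (a$1 * b$3 - a$3 * b$1) * (c$2 * d$4 - c$4 * d$2)
   + (a$1 * b$4 - a$4 * b$1) * (c$2 * d$3 - c$3 * d$2)
   + (a$2 * b$3 - a$3 * b$2) * (c$1 * d$4 - c$4 * d$1)
   - (a$2 * b$4 - a$4 * b$2) * (c$1 * d$3 - c$3 * d$1)
   + (a$3 * b$4 - a$4 * b$3) * (c$1 * d$2 - c$2 * d$1)"
  unfolding det4_def det_4 vector_4 ..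

lemma det4_repeat:
  "det4 a a c d = 0" "det4 a b a d = 0" "det4 a b c a = 0"
  "det4 a b b d = 0" "det4 a b c b = 0" "det4 a b c c = 0"
  unfolding det4_expand by algebra+

text \<open>The rows are those of the identity matrix rearranged by the indices: distinct indices
  give the sign, a repeated one gives 0. Concrete values can then be computed from a
  polynomial.\<close>

lemma levi_civita_eq_det4:
  "levi_civita i j k l = det4 (axis i 1) (axis j 1) (axis k 1) (axis l 1)"
proof -
  let ?p = "($) (vector [i, j, k, l] :: 4^4)"
  let ?M = "vector [axis i 1, axis j 1, axis k 1, axis l 1] :: real^4^4"
  have M: "?M = (\<chi> r. (mat 1 :: real^4^4) $ ?p r)"
    by (auto simp: vec_eq_iff forall_4 vector_4 mat_def axis_def)
  show ?thesis
  proof (cases "distinct [i, j, k, l]")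
    case True
    have "inj ?p"
      using True unfolding inj_def forall_4 by (auto simp: vector_4)
    then have "?p permutes UNIV"
      by (simp add: permutes_def finite_UNIV_inj_surj bij_iff[symmetric] bij_def)
    then have "det ?M = of_int (sign ?p)"
      unfolding M by (simp add: det_permute_rows)
    then show ?thesis
      using True by (simp add: levi_civita_def det4_def)
  next
    case False
    have "det4 (axis i 1) (axis j 1) (axis k 1) (axis l 1) = 0"
      using False by (auto simp: det4_repeat)
    then show ?thesis
      using False by (simp add: levi_civita_def)
  qed
qed

text \<open>A bivector in dimension four has six independent entries, and the star exchanges
  complementary index pairs up to sign. The left sides are exactly the minors in
  \<open>det4_expand\<close>, ready for rewriting.\<close>

lemma wedge_eq_hodge_starD:
  assumes "wedge a b = hodge_star (wedge c d)"
  shows "a$1 * b$2 - a$2 * b$1 = c$3 * d$4 - c$4 * d$3"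
    and "a$1 * b$3 - a$3 * b$1 = c$4 * d$2 - c$2 * d$4"
    and "a$1 * b$4 - a$4 * b$1 = c$2 * d$3 - c$3 * d$2"
    and "a$2 * b$3 - a$3 * b$2 = c$1 * d$4 - c$4 * d$1"
    and "a$2 * b$4 - a$4 * b$2 = c$3 * d$1 - c$1 * d$3"
    and "a$3 * b$4 - a$4 * b$3 = c$1 * d$2 - c$2 * d$1"
proof -
  have *: "wedge a b $ i $ k = hodge_star (wedge c d) $ i $ k" for i k
    using assms by simp
  note expand = wedge_def hodge_star_def sum_4 levi_civita_eq_det4 det4_expand axis_def
  show "a$1 * b$2 - a$2 * b$1 = c$3 * d$4 - c$4 * d$3"
    using *[of 1 2] by (simp add: expand; algebra)
  show "a$1 * b$3 - a$3 * b$1 = c$4 * d$2 - c$2 * d$4"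
    using *[of 1 3] by (simp add: expand; algebra)
  show "a$1 * b$4 - a$4 * b$1 = c$2 * d$3 - c$3 * d$2"
    using *[of 1 4] by (simp add: expand; algebra)
  show "a$2 * b$3 - a$3 * b$2 = c$1 * d$4 - c$4 * d$1"
    using *[of 2 3] by (simp add: expand; algebra)
  show "a$2 * b$4 - a$4 * b$2 = c$3 * d$1 - c$1 * d$3"
    using *[of 2 4] by (simp add: expand; algebra)
  show "a$3 * b$4 - a$4 * b$3 = c$1 * d$2 - c$2 * d$1"
    using *[of 3 4] by (simp add: expand; algebra)
qed

text \<open>Absorbs the minus sign of the \<open>x\<close>-equation, so that both equations take the
  same form.\<close>

lemma minus_hodge_star_wedge: "- hodge_star (wedge a b) = hodge_star (wedge b a)"
  by (simp add: vec_eq_iff hodge_star_def wedge_def sum_negf[symmetric] algebra_simps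
      flip: sum_divide_distrib)

text \<open>By Laplace expansion the determinant sees \<open>a\<close> and \<open>b\<close> only
  through their minors; inserting the dual minors leaves a 2 by 2 Gram determinant. The second part
  reflects that the star is an involution on bivectors here.\<close>

lemma det4_of_wedge_eq_hodge_star:
  assumes "wedge a b = hodge_star (wedge c d)"
  shows "det4 a b u v = (c \<bullet> u) * (d \<bullet> v) - (c \<bullet> v) * (d \<bullet> u)"
    and "det4 c d u v = (a \<bullet> u) * (b \<bullet> v) - (a \<bullet> v) * (b \<bullet> u)"
proof -
  show "det4 a b u v = (c \<bullet> u) * (d \<bullet> v) - (c \<bullet> v) * (d \<bullet> u)"
    unfolding det4_expand wedge_eq_hodge_starD[OF assms] inner_vec_def sum_4 inner_real_def
    by algebra
  \<comment> \<open>Cauchy-Binet identity: it exposes the minors of \<open>a\<close> and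
    \<open>b\<close> for rewriting.\<close>
  have "(a \<bullet> u) * (b \<bullet> v) - (a \<bullet> v) * (b \<bullet> u) =
      (a$1 * b$2 - a$2 * b$1) * (u$1 * v$2 - u$2 * v$1)
    + (a$1 * b$3 - a$3 * b$1) * (u$1 * v$3 - u$3 * v$1)
    + (a$1 * b$4 - a$4 * b$1) * (u$1 * v$4 - u$4 * v$1)
    + (a$2 * b$3 - a$3 * b$2) * (u$2 * v$3 - u$3 * v$2)
    + (a$2 * b$4 - a$4 * b$2) * (u$2 * v$4 - u$4 * v$2)
    + (a$3 * b$4 - a$4 * b$3) * (u$3 * v$4 - u$4 * v$3)"
    unfolding inner_vec_def sum_4 inner_real_def by algebra
  then show "det4 c d u v = (a \<bullet> u) * (b \<bullet> v) - (a \<bullet> v) * (b \<bullet> u)"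
    unfolding det4_expand wedge_eq_hodge_starD[OF assms] by algebra
qed

lemma det4_swap: "det4 a c b d = - det4 a b c d"
  unfolding det4_expand by algebra

lemma lelieuvre_pointwise:
  assumes x: "wedge f fx = hodge_star (wedge \<nu>y \<nu>)"
    and y: "wedge f fy = hodge_star (wedge \<nu> \<nu>x)"
    and "\<nu> \<noteq> 0" and f\<nu>: "f \<bullet> \<nu> = 0"
    and dx: "fx \<bullet> \<nu> + f \<bullet> \<nu>x = 0" and dy: "fy \<bullet> \<nu> + f \<bullet> \<nu>y = 0"
  shows "f \<bullet> \<nu>x = 0" and "f \<bullet> \<nu>y = 0" and "fx \<bullet> \<nu> = 0" and "fy \<bullet> \<nu> = 0"
    and "fx \<bullet> \<nu>x = fy \<bullet> \<nu>y"
    and "det4 f fx fy v = (fx \<bullet> \<nu>x) * (v \<bullet> \<nu>)"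
    and "det4 \<nu> \<nu>x \<nu>y v = - (fx \<bullet> \<nu>x) * (f \<bullet> v)"
proof -
  note detx = det4_of_wedge_eq_hodge_star[OF x]
  note dety = det4_of_wedge_eq_hodge_star[OF y]
  have nz: "\<nu> \<bullet> \<nu> \<noteq> 0"
    using \<open>\<nu> \<noteq> 0\<close> by simp
  \<comment> \<open>The column \<open>f\<close> occurs twice, and tangency kills one of the two
    products, leaving a multiple of the nonzero \<open>\<nu> \<bullet> \<nu>\<close>.\<close>
  show "f \<bullet> \<nu>y = 0"
    using detx(1)[of f \<nu>] nz f\<nu> by (simp add: det4_repeat inner_commute)
  moreover show "f \<bullet> \<nu>x = 0"
    using dety(1)[of f \<nu>] nz f\<nu> by (simp add: det4_repeat inner_commute)
  ultimately show fx\<nu>: "fx \<bullet> \<nu> = 0" and fy\<nu>: "fy \<bullet> \<nu> = 0"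
    using dx dy by simp_all
  have 1: "det4 f fx fy v = (fy \<bullet> \<nu>y) * (v \<bullet> \<nu>)" for v
    using detx(1)[of fy v] fy\<nu> by (simp add: inner_commute)
  have 2: "det4 f fx fy v = (fx \<bullet> \<nu>x) * (v \<bullet> \<nu>)" for v
    using dety(1)[of fx v] fx\<nu> det4_swap[of f fy fx v] by (simp add: inner_commute)
  show "det4 f fx fy v = (fx \<bullet> \<nu>x) * (v \<bullet> \<nu>)"
    by (rule 2)
  show eq: "fx \<bullet> \<nu>x = fy \<bullet> \<nu>y"
    using 1[of \<nu>] 2[of \<nu>] nz by simp
  show "det4 \<nu> \<nu>x \<nu>y v = - (fx \<bullet> \<nu>x) * (f \<bullet> v)"
    using dety(2)[of \<nu>y v] \<open>f \<bullet> \<nu>y = 0\<close> eq by simp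
qed

section \<open>Partial derivatives of smooth maps\<close>

text \<open>On an open set derivatives are local, so agreement passes to every directional
  derivative; hence the induction must generalize both functions.\<close>

lemma Ck_on_cong:
  assumes "open D" and "\<And>p. p \<in> D \<Longrightarrow> f p = g p" and "Ck_on k D f"
  shows "Ck_on k D g"
  using assms(2,3)
proof (induction k arbitrary: f g)
  case 0
  then show ?case
    by (simp cong: continuous_on_cong)
next
  case (Suc k)
  have der: "(g has_derivative frechet_derivative f (at p)) (at p)" if "p \<in> D" for p
  proof -
    have "(f has_derivative frechet_derivative f (at p)) (at p)"
      using Suc.prems(2) that by (simp flip: frechet_derivative_works)
    then show ?thesis
      by (rule has_derivative_transform_within_open[OF _ \<open>open D\<close> that]) (rule Suc.prems(1))
  qed
  then have "frechet_derivative f (at p) = frechet_derivative g (at p)" if "p \<in> D" for p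
    using that by (metis frechet_derivative_at)
  then have "Ck_on k D (\<lambda>p. frechet_derivative g (at p) v)" for v
    using Suc.IH[of "\<lambda>p. frechet_derivative f (at p) v" "\<lambda>p. frechet_derivative g (at p) v"]
      Suc.prems(2) by simp
  then show ?case
    using der by (auto simp: differentiable_def)
qed

lemma smooth_on_differentiable:
  assumes "smooth_on D f" and "p \<in> D"
  shows "f differentiable at p"
proof -
  have "Ck_on (Suc 0) D f"
    using assms unfolding smooth_on_def by blast
  with assms show ?thesis
    by simp
qed

lemma smooth_on_directional:
  assumes "smooth_on D f"
  shows "smooth_on D (\<lambda>p. frechet_derivative f (at p) v)"
proof -
  have "Ck_on (Suc k) D f" for k
    using assms unfolding smooth_on_def by blast
  then show ?thesis
    unfolding smooth_on_def by simp
qed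

lemma differentiable_has_partial_x:
  assumes "f differentiable at p"
  shows "((\<lambda>t. f (t, snd p)) has_vector_derivative partial_x f p) (at (fst p))"
    and "partial_x f p = frechet_derivative f (at p) (1, 0)"
proof -
  have "(f has_derivative frechet_derivative f (at p)) (at (fst p, snd p))"
    using assms by (simp flip: frechet_derivative_works)
  moreover have "((\<lambda>t. (t, snd p)) has_vector_derivative (1, 0)) (at (fst p))"
    by (auto intro!: derivative_eq_intros has_vector_derivative_Pair)
  ultimately have *: "((\<lambda>t. f (t, snd p)) has_vector_derivative frechet_derivative f (at p) (1, 0))
      (at (fst p))"
    using vector_derivative_diff_chain_within[of "\<lambda>t. (t, snd p)" "(1, 0)" "fst p" UNIV f]
    by (simp add: o_def has_derivative_at_withinI)
  then show "partial_x f p = frechet_derivative f (at p) (1, 0)"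
    unfolding partial_x_def by (rule vector_derivative_at)
  with * show "((\<lambda>t. f (t, snd p)) has_vector_derivative partial_x f p) (at (fst p))"
    by simp
qed

lemma differentiable_has_partial_y:
  assumes "f differentiable at p"
  shows "((\<lambda>t. f (fst p, t)) has_vector_derivative partial_y f p) (at (snd p))"
    and "partial_y f p = frechet_derivative f (at p) (0, 1)"
proof -
  have "(f has_derivative frechet_derivative f (at p)) (at (fst p, snd p))"
    using assms by (simp flip: frechet_derivative_works)
  moreover have "((\<lambda>t. (fst p, t)) has_vector_derivative (0, 1)) (at (snd p))"
    by (auto intro!: derivative_eq_intros has_vector_derivative_Pair)
  ultimately have *: "((\<lambda>t. f (fst p, t)) has_vector_derivative frechet_derivative f (at p) (0, 1))
      (at (snd p))"
    using vector_derivative_diff_chain_within[of "\<lambda>t. (fst p, t)" "(0, 1)" "snd p" UNIV f]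
    by (simp add: o_def has_derivative_at_withinI)
  then show "partial_y f p = frechet_derivative f (at p) (0, 1)"
    unfolding partial_y_def by (rule vector_derivative_at)
  with * show "((\<lambda>t. f (fst p, t)) has_vector_derivative partial_y f p) (at (snd p))"
    by simp
qed

text \<open>Partial derivatives agree with directional derivatives where the function is
  differentiable, known here only on \<open>D\<close>, so \<open>Ck_on_cong\<close> transfers
  smoothness.\<close>

lemma smooth_on_partial:
  assumes "open D" and "smooth_on D f"
  shows "smooth_on D (partial_x f)" and "smooth_on D (partial_y f)"
proof -
  have x: "frechet_derivative f (at p) (1, 0) = partial_x f p"
    and y: "frechet_derivative f (at p) (0, 1) = partial_y f p" if "p \<in> D" for p
    using smooth_on_differentiable[OF assms(2) that]
    by (simp_all only: differentiable_has_partial_x(2) differentiable_has_partial_y(2))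
  show "smooth_on D (partial_x f)"
    using smooth_on_directional[OF assms(2), of "(1, 0)"]
      Ck_on_cong[of D "\<lambda>p. frechet_derivative f (at p) (1, 0)" "partial_x f", OF \<open>open D\<close> x]
    unfolding smooth_on_def by blast
  show "smooth_on D (partial_y f)"
    using smooth_on_directional[OF assms(2), of "(0, 1)"]
      Ck_on_cong[of D "\<lambda>p. frechet_derivative f (at p) (0, 1)" "partial_y f", OF \<open>open D\<close> y]
    unfolding smooth_on_def by blast
qed

lemma partial_orthogonal:
  fixes u v :: "real \<times> real \<Rightarrow> 'b::real_inner"
  assumes "open D" and "smooth_on D u" and "smooth_on D v"
    and orth: "\<And>q. q \<in> D \<Longrightarrow> u q \<bullet> v q = 0" and "p \<in> D"
  shows "partial_x u p \<bullet> v p + u p \<bullet> partial_x v p = 0"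
    and "partial_y u p \<bullet> v p + u p \<bullet> partial_y v p = 0"
proof -
  note du = smooth_on_differentiable[OF assms(2) \<open>p \<in> D\<close>]
  note dv = smooth_on_differentiable[OF assms(3) \<open>p \<in> D\<close>]
  let ?X = "(\<lambda>t. (t, snd p)) -` D" and ?Y = "(\<lambda>t. (fst p, t)) -` D"
  have X: "open ?X" and Y: "open ?Y"
    using \<open>open D\<close> by (auto intro!: open_vimage continuous_intros)
  have "((\<lambda>t. u (t, snd p) \<bullet> v (t, snd p)) has_vector_derivative
      u p \<bullet> partial_x v p + partial_x u p \<bullet> v p) (at (fst p))"
    using bounded_bilinear.has_vector_derivative[OF bounded_bilinear_inner
      differentiable_has_partial_x(1)[OF du] differentiable_has_partial_x(1)[OF dv]] by simp
  \<comment> \<open>The product vanishes on the open slice \<open>?X\<close>, so the Leibniz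
    expression is also a derivative of the zero function.\<close>
  from has_vector_derivative_transform_within_open[OF this X, of "\<lambda>_. 0"]
  have "((\<lambda>_. 0) has_vector_derivative
      u p \<bullet> partial_x v p + partial_x u p \<bullet> v p) (at (fst p))"
    using orth \<open>p \<in> D\<close> by simp
  from vector_derivative_at[OF this] show "partial_x u p \<bullet> v p + u p \<bullet> partial_x v p = 0"
    by simp
  have "((\<lambda>t. u (fst p, t) \<bullet> v (fst p, t)) has_vector_derivative
      u p \<bullet> partial_y v p + partial_y u p \<bullet> v p) (at (snd p))"
    using bounded_bilinear.has_vector_derivative[OF bounded_bilinear_inner
      differentiable_has_partial_y(1)[OF du] differentiable_has_partial_y(1)[OF dv]] by simp
  from has_vector_derivative_transform_within_open[OF this Y, of "\<lambda>_. 0"]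
  have "((\<lambda>_. 0) has_vector_derivative
      u p \<bullet> partial_y v p + partial_y u p \<bullet> v p) (at (snd p))"
    using orth \<open>p \<in> D\<close> by simp
  from vector_derivative_at[OF this] show "partial_y u p \<bullet> v p + u p \<bullet> partial_y v p = 0"
    by simp
qed

section \<open>The determinant identities\<close>

theorem theorem3p2:
  fixes D :: "(real \<times> real) set" and f \<nu> :: "real \<times> real \<Rightarrow> real^4"
  assumes "open D"
    and "smooth_on D f" and "smooth_on D \<nu>"
    and "\<forall>p\<in>D. f p \<noteq> 0" and "\<forall>p\<in>D. \<nu> p \<noteq> 0"
    and "\<forall>p\<in>D. f p \<bullet> \<nu> p = 0"
    and "elliptic_lelieuvre_on D f \<nu>"
  shows "\<forall>p\<in>D.
     det4 (f p) (partial_x f p) (partial_y f p) (partial_x (partial_x f) p) =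
       - det4 (\<nu> p) (partial_x \<nu> p) (partial_y \<nu> p) (partial_x (partial_x \<nu>) p) \<and>
     det4 (f p) (partial_x f p) (partial_y f p) (partial_y (partial_y f) p) =
       - det4 (\<nu> p) (partial_x \<nu> p) (partial_y \<nu> p) (partial_y (partial_y \<nu>) p)"
proof
  fix p assume "p \<in> D"
  note orthogonal = partial_orthogonal[OF \<open>open D\<close>]
  note sf = \<open>smooth_on D f\<close> smooth_on_partial[OF \<open>open D\<close> \<open>smooth_on D f\<close>]
  note s\<nu> = \<open>smooth_on D \<nu>\<close> smooth_on_partial[OF \<open>open D\<close> \<open>smooth_on D \<nu>\<close>]
  have x: "wedge (f q) (partial_x f q) = hodge_star (wedge (partial_y \<nu> q) (\<nu> q))"
    and y: "wedge (f q) (partial_y f q) = hodge_star (wedge (\<nu> q) (partial_x \<nu> q))"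
    if "q \<in> D" for q
    using assms(7) that unfolding elliptic_lelieuvre_on_def minus_hodge_star_wedge by auto
  have nz: "\<nu> q \<noteq> 0" and f\<nu>: "f q \<bullet> \<nu> q = 0" if "q \<in> D" for q
    using assms(5,6) that by auto
  \<comment> \<open>These relations hold at every point of \<open>D\<close>, not just at
    \<open>p\<close>, so they can be differentiated once more below.\<close>
  note pw = lelieuvre_pointwise[OF x y nz f\<nu> orthogonal(1)[OF sf(1) s\<nu>(1) f\<nu>]
      orthogonal(2)[OF sf(1) s\<nu>(1) f\<nu>]]
  let ?a = "partial_x f p \<bullet> partial_x \<nu> p"
  have eq: "?a = partial_y f p \<bullet> partial_y \<nu> p"
    using pw(5) \<open>p \<in> D\<close> by blast
  have "partial_x (partial_x f) p \<bullet> \<nu> p = - ?a"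
    using orthogonal(1)[OF sf(2) s\<nu>(1) pw(3) \<open>p \<in> D\<close>] by simp
  moreover have "partial_y (partial_y f) p \<bullet> \<nu> p = - ?a"
    using orthogonal(2)[OF sf(3) s\<nu>(1) pw(4) \<open>p \<in> D\<close>] eq by simp
  moreover have "f p \<bullet> partial_x (partial_x \<nu>) p = - ?a"
    using orthogonal(1)[OF sf(1) s\<nu>(2) pw(1) \<open>p \<in> D\<close>] by simp
  moreover have "f p \<bullet> partial_y (partial_y \<nu>) p = - ?a"
    using orthogonal(2)[OF sf(1) s\<nu>(3) pw(2) \<open>p \<in> D\<close>] eq by simp
  moreover have "det4 (f p) (partial_x f p) (partial_y f p) v = ?a * (v \<bullet> \<nu> p)"
    and "det4 (\<nu> p) (partial_x \<nu> p) (partial_y \<nu> p) v = - ?a * (f p \<bullet> v)" for v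
    using pw(6,7) \<open>p \<in> D\<close> by blast+
  ultimately show
    "det4 (f p) (partial_x f p) (partial_y f p) (partial_x (partial_x f) p) =
       - det4 (\<nu> p) (partial_x \<nu> p) (partial_y \<nu> p) (partial_x (partial_x \<nu>) p) \<and>
     det4 (f p) (partial_x f p) (partial_y f p) (partial_y (partial_y f) p) =
       - det4 (\<nu> p) (partial_x \<nu> p) (partial_y \<nu> p) (partial_y (partial_y \<nu>) p)"
    by simp
qed

end
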